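(* The ordinary generating function $\sum_{n\ge 0}|\mathfrak{D}^4_{2n}(1423)|\,z^n$ is obtained from $R_1(z)/z = zR_1(z)/z^2$ by substituting $\sqrt{z}$ for $z$; that is, as formal power series, $$\sum_{n\ge 0}|\mathfrak{D}^4_{2n}(1423)|\,z^{2n}=\frac{R_1(z)}{z},$$ where the sequence of functions $zR_{2k+1}=zR_{2k+1}(z)$, $k\ge 0$, satisfies, for all $k\ge 0$, the recurrence relation $$zR_{2k+1} = \cfrac{z^2C_{e,2k}}{(1-zC_{o,2k-1})^2-\cfrac{z^2C_{e,2k}}{1-zC_{o,2k+1}-\cfrac{z^2C_{e,2k}^2}{1-zR_{2k+3}}}}.$$
   Context: A permutation $\pi$ of $[N]=\{1,\dots,N\}$ is written as $\pi(1)\pi(2)\cdots\pi(N)$. A Dumont permutation of the fourth kind (Dumont-4 permutation) of size $2n$ is a permutation $\pi$ of $[2n]$ in which all deficiencies are even values at even positions: for all $1\le i\le 2n$, if $\pi(i)<i$ then both $i$ and $\pi(i)$ are even. The set of these is $\mathfrak{D}^4_{2n}$ (for $n=0$ it consists of the empty permutation). A permutation $\pi$ of $[N]$ contains a pattern $\tau\in S_k$ if there are indices $i_1<\dots<i_k$ such that for all $a,b$, $\pi(i_a)<\pi(i_b)$ if and only if $\tau(a)<\tau(b)$; otherwise $\pi$ avoids $\tau$. $\mathfrak{D}^4_{2n}(\tau)$ denotes the set of permutations in $\mathfrak{D}^4_{2n}$ avoiding $\tau$. Let $C_i=\frac{1}{i+1}\binom{2i}{i}$ be the Catalan numbers, and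 define the truncations $$C_{e,2m}=\sum_{i=0}^{m}C_{2i}z^{2i},\qquad C_{o,2m+1}=\sum_{i=0}^{m}C_{2i+1}z^{2i+1},$$ these being $0$ when $m<0$ (so $C_{o,-1}=0$). For $k\ge 0$ put $m=2k+1$. For a permutation $\sigma$ of $[N]$, drawn as dots in column $i$ and row $\sigma(i)$ of an $N\times N$ board (rows numbered from the bottom), a position $i$ is an $m$-deficiency if $\sigma(i)\le i-m$ (so the bottom row has its first $m$ cells, or all its cells if $N<m$, free of $m$-deficiencies, and the $1$-deficiencies for $m=1$ are the usual deficiencies $\sigma(i)<i$). The generating function $R_{2k+1}(z)=\sum_{N}r_{N}z^{N}$ runs over odd $N\ge 1$, where $r_N$ is the number of $312$-avoiding permutations $\sigma$ of $[N]$ all of whose $m$-deficiencies (with $m=2k+1$) are even values in even positions, i.e. $\sigma(i)\le i-m$ implies that $i$ and $\sigma(i)$ are both even; cells with $\sigma(i)>i-m$ are unrestricted. *)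

theory Defs
  imports "HOL-Computational_Algebra.Formal_Power_Series" "HOL-Combinatorics.Permutations"
begin

(* A permutation of [N] is a function p with p permutes {1..N}, i.e. a bijection of {1..N} that is
   the identity outside of it. *)

(* A pattern is given in one-line notation as a list t; the list js holds the indices
   i_1 < ... < i_k of an occurrence. *)
definition contains_pattern :: "nat \<Rightarrow> (nat \<Rightarrow> nat) \<Rightarrow> nat list \<Rightarrow> bool" where
  "contains_pattern N p t \<longleftrightarrow>
     (\<exists>js :: nat list. length js = length t \<and> sorted_wrt (<) js \<and> set js \<subseteq> {1..N} \<and>
        (\<forall>a<length t. \<forall>b<length t. p (js ! a) < p (js ! b) \<longleftrightarrow> t ! a < t ! b))"

definition dumont4 :: "nat \<Rightarrow> (nat \<Rightarrow> nat) set" where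
  "dumont4 n = {p. p permutes {1..2 * n} \<and>
                   (\<forall>i\<in>{1..2 * n}. p i < i \<longrightarrow> even i \<and> even (p i))}"

definition dumont4_avoiding :: "nat list \<Rightarrow> nat \<Rightarrow> (nat \<Rightarrow> nat) set" where
  "dumont4_avoiding t n = {p \<in> dumont4 n. \<not> contains_pattern (2 * n) p t}"

definition catalan :: "nat \<Rightarrow> rat" where
  "catalan i = of_nat ((2 * i) choose i) / of_nat (i + 1)"

(* The argument j is the subscript of the truncations C_{e,j} (j even) and C_{o,j} (j odd). It is
   an integer, so that C_{o,-1} is available and equals 0. *)
definition C_even :: "int \<Rightarrow> rat fps" where
  "C_even j = (\<Sum>i | 2 * int i \<le> j. fps_const (catalan (2 * i)) * fps_X ^ (2 * i))"

definition C_odd :: "int \<Rightarrow> rat fps" where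
  "C_odd j = (\<Sum>i | 2 * int i + 1 \<le> j. fps_const (catalan (2 * i + 1)) * fps_X ^ (2 * i + 1))"

(* The condition s i + m \<le> i is s(i) \<le> i - m without truncated subtraction. *)
definition R_perms :: "nat \<Rightarrow> nat \<Rightarrow> (nat \<Rightarrow> nat) set" where
  "R_perms m N = {s. s permutes {1..N} \<and> \<not> contains_pattern N s [3, 1, 2] \<and>
                     (\<forall>i\<in>{1..N}. s i + m \<le> i \<longrightarrow> even i \<and> even (s i))}"

definition R_gf :: "nat \<Rightarrow> rat fps" where
  "R_gf m = Abs_fps (\<lambda>N. if odd N then of_nat (card (R_perms m N)) else 0)"

end

theory Submission
  imports Defs
begin

text \<open>
  A deficiency of a Dumont-4 permutation has an even value, so the value \<open>1\<close> is not a
  deficiency and stands in the first position. Behind an initial \<open>1\<close>, avoiding \<open>1423\<close> means that the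
  remaining entries avoid \<open>312\<close>. Extending the permutation of \<open>[2n]\<close> by the fixed point \<open>2n + 1\<close>
  creates neither a pattern \<open>312\<close> nor a deficiency, and conversely an odd last position can only
  carry the largest value. Hence \<open>dumont4_avoiding [1, 4, 2, 3] n\<close> and the set counted by the coefficient of
  \<open>z^(2n + 1)\<close> in \<open>R\<^sub>1\<close> are the same set of functions (lemma \<open>dumont4_avoiding_eq\<close>).

  For the recurrence, cut a \<open>312\<close>-avoiding permutation at its value \<open>1\<close>, in position \<open>j + 1\<close> say:
  every entry before the \<open>1\<close> is smaller than every entry after it, so the permutation consists of a
  \<open>312\<close>-avoider of \<open>[j]\<close> raised by \<open>1\<close>, the value \<open>1\<close>, and a \<open>312\<close>-avoider shifted by \<open>j + 1\<close> in
  positions and values. Raising by \<open>1\<close> turns an \<open>m\<close>-deficiency into an \<open>(m + 1)\<close>-deficiency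
  and flips the parity prescribed for the value; shifting by \<open>j + 1\<close> keeps \<open>m\<close> and flips both
  prescribed parities if \<open>j + 1\<close> is odd. So the counts for the four pairs of prescribed parities
  (position, value) satisfy a closed system of recurrences. With \<open>m = 2k + 1\<close>, let \<open>R\<close> and \<open>S\<close>
  belong to \<open>m\<close> and the parities even-even (odd sizes) and odd-odd (even sizes), and let \<open>E\<close> and
  \<open>O\<close> belong to \<open>m + 1\<close> and the parities odd-even (even sizes) and even-odd (odd sizes). Where
  the value \<open>1\<close> is not a deficiency, the part before it is too short to contain one, and it is counted
  by a Catalan number. In the classes of \<open>R\<close> and \<open>E\<close> this is always so; in those of \<open>S\<close> and \<open>O\<close> the
  value \<open>1\<close> may also be a deficiency, and then the part before it is counted by the coefficients of
  \<open>E\<close> and \<open>R'\<close>, the latter being the series \<open>R\<close> for \<open>m + 2\<close>, whose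
  coefficients at odd powers up to \<open>z^(m + 2)\<close> are Catalan numbers as well. This yields
  \<open>R = z C\<^sub>o R + z C\<^sub>e S\<close>, \<open>S = 1 + z C\<^sub>o S + z E R\<close>,
  \<open>E = 1 + z C\<^sub>o' E + z C\<^sub>e O\<close>, \<open>O = z R' O + z C\<^sub>e E\<close>,
  where \<open>C\<^sub>o\<close>, \<open>C\<^sub>o'\<close> and \<open>C\<^sub>e\<close> are the truncations with indices \<open>2k - 1\<close>, \<open>2k + 1\<close> and \<open>2k\<close>.
  Eliminating \<open>O\<close>, \<open>E\<close> and \<open>S\<close> in turn gives the continued fraction. The lemmas carrying this are \<open>card_avoiders_Suc\<close> (the cut), \<open>parity_gf_parity_count\<close> (the
  system) and \<open>R_gf_recurrence\<close> (the elimination).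
\<close>

unbundle fps_syntax

section \<open>Catalan numbers\<close>

lemma catalan_0 [simp]: "catalan 0 = 1"
  by (simp add: catalan_def)

lemma catalan_Suc: "catalan (Suc n) * of_nat (n + 2) = 2 * of_nat (2 * n + 1) * catalan n"
proof -
  have "Suc n * (Suc (2 * n + 1) choose Suc n) = Suc (2 * n + 1) * ((2 * n + 1) choose n)"
    by (rule Suc_times_binomial)
  then have "Suc n * ((2 * Suc n) choose Suc n) = Suc n * (2 * ((2 * n + 1) choose n))"
    by (simp del: binomial_Suc_Suc)
  then have a: "(2 * Suc n) choose Suc n = 2 * ((2 * n + 1) choose n)"
    by (simp only: mult_cancel1) simp
  have "Suc n * (Suc (2 * n) choose Suc n) = Suc (2 * n) * ((2 * n) choose n)"
    by (rule Suc_times_binomial)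
  moreover have "Suc (2 * n) choose Suc n = (2 * n + 1) choose n"
    by (subst binomial_symmetric) auto
  ultimately have "(n + 1) * ((2 * Suc n) choose Suc n) = 2 * (2 * n + 1) * ((2 * n) choose n)"
    unfolding a by (simp del: binomial_Suc_Suc add: algebra_simps)
  then have "of_nat (n + 1) * of_nat ((2 * Suc n) choose Suc n) =
      2 * of_nat (2 * n + 1) * (of_nat ((2 * n) choose n) :: rat)"
    by (metis of_nat_mult of_nat_numeral)
  then show ?thesis
    unfolding catalan_def by (simp del: binomial_Suc_Suc add: field_simps)
qed

text \<open>
  These are the coefficients of \<open>sqrt (1 - 4z)\<close>, which equals \<open>1 - 2z C(z)\<close> for the Catalan series
  \<open>C\<close>. The Vandermonde identity for \<open>1/2 + 1/2 = 1\<close> then yields the Catalan recurrence.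
\<close>

lemma gbinomial_half:
  "((1/2 :: rat) gchoose Suc n) * (-4) ^ Suc n = -2 * catalan n"
proof (induction n)
  case 0
  then show ?case by simp
next
  case (Suc n)
  have "of_nat (n + 2) * ((1/2 :: rat) gchoose Suc (Suc n)) =
      (1/2 - of_nat (Suc n)) * ((1/2) gchoose Suc n)"
    using gbinomial_absorb_comp[of "1/2 :: rat" "Suc n"] gbinomial_absorption[of "Suc n" "1/2 :: rat"]
    by simp
  then have *: "of_nat (n + 2) * ((1/2 :: rat) gchoose Suc (Suc n)) * ((-4) * (-4) ^ Suc n) =
      (1/2 - of_nat (Suc n)) * ((1/2) gchoose Suc n) * ((-4) * (-4) ^ Suc n)"
    by (rule arg_cong)
  have "of_nat (n + 2) * (((1/2 :: rat) gchoose Suc (Suc n)) * (-4) ^ Suc (Suc n)) =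
      of_nat (n + 2) * ((1/2 :: rat) gchoose Suc (Suc n)) * ((-4) * (-4) ^ Suc n)"
    by (simp only: power_Suc[of _ "Suc n"] mult.assoc)
  also have "\<dots> = (1/2 - of_nat (Suc n)) * (-4) * (((1/2) gchoose Suc n) * (-4) ^ Suc n)"
    unfolding * by (simp only: ac_simps)
  also have "\<dots> = of_nat (n + 2) * (-2 * catalan (Suc n))"
    unfolding Suc using catalan_Suc[of n] by (simp add: algebra_simps)
  finally show ?case
    by (metis mult_left_cancel of_nat_eq_0_iff add_is_0 zero_neq_numeral)
qed

lemma catalan_convolution:
  "catalan (Suc n) = (\<Sum>i\<le>n. catalan i * catalan (n - i))"
proof -
  define h where "h k = ((1/2 :: rat) gchoose k) * (-4) ^ k" for k
  have h0: "h 0 = 1" and hS: "h (Suc k) = -2 * catalan k" for k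
    unfolding h_def gbinomial_half by simp_all
  have "(\<Sum>k\<le>Suc (Suc n). h k * h (Suc (Suc n) - k)) =
      (\<Sum>k=0..Suc (Suc n). ((1/2) gchoose k) * ((1/2) gchoose (Suc (Suc n) - k))) * (-4) ^ Suc (Suc n)"
    unfolding sum_distrib_right atLeast0AtMost
  proof (rule sum.cong[OF refl])
    fix k assume "k \<in> {..Suc (Suc n)}"
    then have "(-4 :: rat) ^ Suc (Suc n) = (-4) ^ k * (-4) ^ (Suc (Suc n) - k)"
      by (subst power_add[symmetric]) auto
    then show "h k * h (Suc (Suc n) - k) =
        ((1/2) gchoose k) * ((1/2) gchoose (Suc (Suc n) - k)) * (-4) ^ Suc (Suc n)"
      unfolding h_def by simp
  qed
  also have "\<dots> = 0"
  proof -
    have "(1 :: rat) gchoose Suc (Suc n) = 0"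
      using binomial_gbinomial[of 1 "Suc (Suc n)", where 'a = rat] by simp
    then show ?thesis
      by (subst gbinomial_Vandermonde) simp
  qed
  finally have "(\<Sum>k\<le>Suc (Suc n). h k * h (Suc (Suc n) - k)) = 0" .
  moreover have "(\<Sum>k\<le>Suc (Suc n). h k * h (Suc (Suc n) - k)) =
      2 * h (Suc (Suc n)) + (\<Sum>k\<le>n. h (Suc k) * h (Suc (n - k)))"
    unfolding sum.atMost_Suc_shift[of _ "Suc n"] sum.atMost_Suc[of _ n]
    by (simp add: h0 Suc_diff_le)
  ultimately show ?thesis
    by (simp add: hS sum_distrib_left[symmetric])
qed

section \<open>Occurrences of the two patterns\<close>

lemma contains_pattern_312_iff:
  "contains_pattern N p [3, 1, 2] \<longleftrightarrow>
     (\<exists>a b c. 1 \<le> a \<and> a < b \<and> b < c \<and> c \<le> N \<and> p b < p c \<and> p c < p a)"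
proof
  assume "contains_pattern N p [3, 1, 2]"
  then obtain js :: "nat list" where js: "length js = length [3, 1, 2 :: nat]"
      "sorted_wrt (<) js" "set js \<subseteq> {1..N}"
    and *: "\<forall>a<length [3, 1, 2 :: nat]. \<forall>b<length [3, 1, 2 :: nat].
      p (js ! a) < p (js ! b) \<longleftrightarrow> [3, 1, 2 :: nat] ! a < [3, 1, 2] ! b"
    unfolding contains_pattern_def by blast
  obtain a b c where "js = [a, b, c]"
    using js(1) by (auto simp: numeral_eq_Suc length_Suc_conv)
  with js * show "\<exists>a b c. 1 \<le> a \<and> a < b \<and> b < c \<and> c \<le> N \<and> p b < p c \<and> p c < p a"
    by (intro exI[of _ a] exI[of _ b] exI[of _ c]) (auto simp: numeral_eq_Suc All_less_Suc)
next
  assume "\<exists>a b c. 1 \<le> a \<and> a < b \<and> b < c \<and> c \<le> N \<and> p b < p c \<and> p c < p a"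
  then obtain a b c where "1 \<le> a" "a < b" "b < c" "c \<le> N" "p b < p c" "p c < p a"
    by blast
  then show "contains_pattern N p [3, 1, 2]"
    unfolding contains_pattern_def
    by (intro exI[of _ "[a, b, c]"]) (auto simp: numeral_eq_Suc All_less_Suc)
qed

lemma contains_pattern_1423_iff:
  "contains_pattern N p [1, 4, 2, 3] \<longleftrightarrow>
     (\<exists>a b c d. 1 \<le> a \<and> a < b \<and> b < c \<and> c < d \<and> d \<le> N \<and> p a < p c \<and> p c < p d \<and> p d < p b)"
proof
  assume "contains_pattern N p [1, 4, 2, 3]"
  then obtain js :: "nat list" where js: "length js = length [1, 4, 2, 3 :: nat]"
      "sorted_wrt (<) js" "set js \<subseteq> {1..N}"
    and *: "\<forall>a<length [1, 4, 2, 3 :: nat]. \<forall>b<length [1, 4, 2, 3 :: nat].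
      p (js ! a) < p (js ! b) \<longleftrightarrow> [1, 4, 2, 3 :: nat] ! a < [1, 4, 2, 3] ! b"
    unfolding contains_pattern_def by blast
  obtain a b c d where "js = [a, b, c, d]"
    using js(1) by (auto simp: numeral_eq_Suc length_Suc_conv)
  with js * show "\<exists>a b c d. 1 \<le> a \<and> a < b \<and> b < c \<and> c < d \<and> d \<le> N \<and> p a < p c \<and> p c < p d \<and> p d < p b"
    by (intro exI[of _ a] exI[of _ b] exI[of _ c] exI[of _ d])
      (auto simp: numeral_eq_Suc All_less_Suc)
next
  assume "\<exists>a b c d. 1 \<le> a \<and> a < b \<and> b < c \<and> c < d \<and> d \<le> N \<and> p a < p c \<and> p c < p d \<and> p d < p b"
  then obtain a b c d where "1 \<le> a" "a < b" "b < c" "c < d" "d \<le> N" "p a < p c" "p c < p d" "p d < p b"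
    by blast
  then show "contains_pattern N p [1, 4, 2, 3]"
    unfolding contains_pattern_def
    by (intro exI[of _ "[a, b, c, d]"]) (auto simp: numeral_eq_Suc All_less_Suc)
qed

section \<open>Splitting a 312-avoiding permutation at its value 1\<close>

text \<open>
  The condition \<open>P i v\<close> on positions and values is kept arbitrary because cutting a permutation at
  its value \<open>1\<close> changes the condition by a translation, so that the family of all these sets is closed
  under the cut.
\<close>

definition avoiders :: "(nat \<Rightarrow> nat \<Rightarrow> bool) \<Rightarrow> nat \<Rightarrow> (nat \<Rightarrow> nat) set" where
  "avoiders P N = {s. s permutes {1..N} \<and>
     (\<forall>a b c. 1 \<le> a \<longrightarrow> a < b \<longrightarrow> b < c \<longrightarrow> c \<le> N \<longrightarrow> \<not> (s b < s c \<and> s c < s a)) \<and>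
     (\<forall>i\<in>{1..N}. P i (s i))}"

lemma finite_avoiders [simp]: "finite (avoiders P N)"
  unfolding avoiders_def by (rule finite_subset[OF _ finite_permutations[of "{1..N}"]]) auto

text \<open>
  Serves to discard the condition on permutations that are too small to have a deficiency.
\<close>

lemma avoiders_cong:
  assumes "\<And>i v. 1 \<le> i \<Longrightarrow> i \<le> N \<Longrightarrow> 1 \<le> v \<Longrightarrow> v \<le> N \<Longrightarrow> P i v \<longleftrightarrow> Q i v"
  shows "avoiders P N = avoiders Q N"
proof -
  have "P i (s i) \<longleftrightarrow> Q i (s i)" if "s permutes {1..N}" "i \<in> {1..N}" for s i
    using permutes_in_image[OF that(1), of i] that(2) assms by auto
  then show ?thesis unfolding avoiders_def by blast
qed

lemma card_avoiders_0 [simp]: "card (avoiders P 0) = 1"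
proof -
  have "avoiders P 0 = {id}" unfolding avoiders_def by auto
  then show ?thesis by simp
qed

lemma permutesI_inj_on:
  assumes "finite A" "f ` A \<subseteq> A" "inj_on f A" "\<And>x. x \<notin> A \<Longrightarrow> f x = x"
  shows "f permutes A"
  using assms endo_inj_surj[of A f] by (intro bij_imp_permutes) (auto simp: bij_betw_def)

lemma down_closed_eq_atLeastAtMost:
  fixes A :: "nat set"
  assumes "finite A" "0 \<notin> A" and dc: "\<And>x y. y \<in> A \<Longrightarrow> 1 \<le> x \<Longrightarrow> x < y \<Longrightarrow> x \<in> A"
  shows "A = {1..card A}"
proof (cases "A = {}")
  case False
  have "A = {1..Max A}"
  proof
    show "A \<subseteq> {1..Max A}"
      using assms(1,2) by (auto simp: Suc_le_eq intro: gr0I)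
    show "{1..Max A} \<subseteq> A"
      using dc[OF Max_in[OF assms(1) False]] Max_in[OF assms(1) False]
      by (auto simp: le_less)
  qed
  moreover from this have "card A = Max A"
    using card_atLeastAtMost[of 1 "Max A"] by simp
  ultimately show ?thesis by simp
qed simp

text \<open>
  An entry before the \<open>1\<close> that exceeds an entry after it would form a \<open>312\<close> with the \<open>1\<close> in the
  middle. So the values of the initial segment ending in the \<open>1\<close> form a down-closed set.
\<close>

lemma avoider_prefix_image:
  assumes s: "s \<in> avoiders P N" and j: "j < N" "s (Suc j) = 1"
  shows "s ` {1..Suc j} = {1..Suc j}"
proof -
  have p: "s permutes {1..N}"
    and av: "\<And>a b c. 1 \<le> a \<Longrightarrow> a < b \<Longrightarrow> b < c \<Longrightarrow> c \<le> N \<Longrightarrow> \<not> (s b < s c \<and> s c < s a)"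
    using s unfolding avoiders_def by auto
  have inj: "s x = s y \<longleftrightarrow> x = y" for x y
    using permutes_inj[OF p] by (rule inj_eq)
  have rng: "1 \<le> s i \<and> s i \<le> N" if "1 \<le> i" "i \<le> N" for i
    using permutes_in_image[OF p, of i] that by auto
  have less: "s a < s c" if "1 \<le> a" "a \<le> Suc j" "Suc j < c" "c \<le> N" for a c
  proof -
    have "s c \<noteq> s (Suc j)" "s c \<noteq> s a" using that by (simp_all add: inj)
    then have "s (Suc j) < s c" using rng[of c] j that by linarith
    then show ?thesis
      using av[of a "Suc j" c] that \<open>s c \<noteq> s a\<close> j by (cases "a = Suc j") auto
  qed
  have "s ` {1..Suc j} = {1..card (s ` {1..Suc j})}"
  proof (rule down_closed_eq_atLeastAtMost)
    show "0 \<notin> s ` {1..Suc j}"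
      using rng j by force
  next
    fix x y assume "y \<in> s ` {1..Suc j}" and x: "1 \<le> x" "x < y"
    then obtain a where a: "1 \<le> a" "a \<le> Suc j" "y = s a" by auto
    then have "x \<in> {1..N}" using rng[of a] x j by auto
    then obtain c where c: "c \<in> {1..N}" "x = s c"
      using permutes_image[OF p] by (metis imageE)
    have "c \<le> Suc j" using less[of a c] a c x by force
    then show "x \<in> s ` {1..Suc j}" using c by auto
  qed simp
  moreover have "card (s ` {1..Suc j}) = Suc j"
    using card_image[of s "{1..Suc j}"] by (simp add: inj_on_def inj)
  ultimately show ?thesis by simp
qed

definition glue :: "nat \<Rightarrow> nat \<Rightarrow> (nat \<Rightarrow> nat) \<times> (nat \<Rightarrow> nat) \<Rightarrow> nat \<Rightarrow> nat" where
  "glue j n = (\<lambda>(t, r) i.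
     if i \<in> {1..j} then Suc (t i)
     else if i = Suc j then 1
     else if i \<in> {Suc (Suc j)..Suc j + n} then r (i - Suc j) + Suc j
     else i)"

text \<open>
  The truncated subtractions are exact on permutations that have the value \<open>1\<close> at position
  \<open>j + 1\<close> and avoid \<open>312\<close>: before the \<open>1\<close> the values are at least \<open>2\<close>, and after it they
  exceed \<open>j + 1\<close>.
\<close>

definition unglue :: "nat \<Rightarrow> nat \<Rightarrow> (nat \<Rightarrow> nat) \<Rightarrow> (nat \<Rightarrow> nat) \<times> (nat \<Rightarrow> nat)" where
  "unglue j n s =
     ((\<lambda>i. if i \<in> {1..j} then s i - 1 else i),
      (\<lambda>i. if i \<in> {1..n} then s (i + Suc j) - Suc j else i))"

text \<open>
  An occurrence of \<open>312\<close> in the glued permutation is excluded by the place of its last entry: if that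
  is in the left part, the occurrence lies in \<open>t\<close>; the \<open>1\<close> has no smaller entry before it; if it is
  in the right part, the first entry is larger still, which forces the whole occurrence into \<open>r\<close>.
\<close>

lemma glue_in_avoiders:
  assumes P1: "P (Suc j) 1"
    and t: "t \<in> avoiders (\<lambda>i v. P i (Suc v)) j"
    and r: "r \<in> avoiders (\<lambda>i v. P (i + Suc j) (v + Suc j)) n"
  shows "glue j n (t, r) \<in> avoiders P (Suc j + n)"
proof -
  let ?g = "glue j n (t, r)"
  have tp: "t permutes {1..j}" and rp: "r permutes {1..n}"
    using t r unfolding avoiders_def by auto
  have tav: "\<And>a b c. 1 \<le> a \<Longrightarrow> a < b \<Longrightarrow> b < c \<Longrightarrow> c \<le> j \<Longrightarrow> \<not> (t b < t c \<and> t c < t a)"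
    and rav: "\<And>a b c. 1 \<le> a \<Longrightarrow> a < b \<Longrightarrow> b < c \<Longrightarrow> c \<le> n \<Longrightarrow> \<not> (r b < r c \<and> r c < r a)"
    and tP: "\<And>i. 1 \<le> i \<Longrightarrow> i \<le> j \<Longrightarrow> P i (Suc (t i))"
    and rP: "\<And>i. 1 \<le> i \<Longrightarrow> i \<le> n \<Longrightarrow> P (i + Suc j) (r i + Suc j)"
    using t r unfolding avoiders_def by auto
  have tr: "1 \<le> t i \<and> t i \<le> j" if "1 \<le> i" "i \<le> j" for i
    using permutes_in_image[OF tp, of i] that by auto
  have rr: "1 \<le> r i \<and> r i \<le> n" if "1 \<le> i" "i \<le> n" for i
    using permutes_in_image[OF rp, of i] that by auto
  have gl: "?g i = Suc (t i)" "2 \<le> ?g i" "?g i \<le> Suc j" if "1 \<le> i" "i \<le> j" for i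
    using that tr[OF that] by (simp_all add: glue_def)
  have g1: "?g (Suc j) = 1" by (simp add: glue_def)
  have gh: "?g i = r (i - Suc j) + Suc j" "Suc j < ?g i" "?g i \<le> Suc j + n"
    if "Suc j < i" "i \<le> Suc j + n" for i
  proof -
    have "1 \<le> i - Suc j" "i - Suc j \<le> n" using that by simp_all
    from rr[OF this] that
    show "?g i = r (i - Suc j) + Suc j" "Suc j < ?g i" "?g i \<le> Suc j + n"
      by (simp_all add: glue_def)
  qed
  have low_iff: "i \<le> j \<longleftrightarrow> 2 \<le> ?g i \<and> ?g i \<le> Suc j"
    and high_iff: "Suc j < i \<longleftrightarrow> Suc j < ?g i" if "1 \<le> i" "i \<le> Suc j + n" for i
    using that gl[of i] gh[of i] g1 by (cases i "Suc j" rule: linorder_cases; simp)+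
  have inj: "x = y" if "1 \<le> x" "x \<le> Suc j + n" "1 \<le> y" "y \<le> Suc j + n" "?g x = ?g y" for x y
  proof (cases x "Suc j" rule: linorder_cases)
    case less
    then have "x \<le> j" "y \<le> j" using low_iff[of x] low_iff[of y] that by simp_all
    then show ?thesis using gl(1)[of x] gl(1)[of y] that inj_eq[OF permutes_inj[OF tp], of x y] by simp
  next
    case equal
    then show ?thesis
      using low_iff[of x] low_iff[of y] high_iff[of x] high_iff[of y] that by simp
  next
    case greater
    then have "Suc j < y" using high_iff[of x] high_iff[of y] that by simp
    then show ?thesis
      using greater gh(1)[of x] gh(1)[of y] that
        inj_eq[OF permutes_inj[OF rp], of "x - Suc j" "y - Suc j"] by simp
  qed
  have rng: "1 \<le> ?g i \<and> ?g i \<le> Suc j + n" if "1 \<le> i" "i \<le> Suc j + n" for i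
    using that gl[of i] gh[of i] g1 by (cases i "Suc j" rule: linorder_cases) simp_all
  have "?g permutes {1..Suc j + n}"
  proof (rule permutesI_inj_on)
    show "?g ` {1..Suc j + n} \<subseteq> {1..Suc j + n}"
      using rng by (simp add: image_subset_iff)
    show "inj_on ?g {1..Suc j + n}"
      using inj by (simp add: inj_on_def)
  qed (auto simp: glue_def)
  moreover have "\<not> (?g b < ?g c \<and> ?g c < ?g a)"
    if abc: "1 \<le> a" "a < b" "b < c" "c \<le> Suc j + n" for a b c
  proof
    assume lt: "?g b < ?g c \<and> ?g c < ?g a"
    show False
    proof (cases c "Suc j" rule: linorder_cases)
      case less
      then show False using lt tav[of a b c] abc by (simp add: gl(1))
    next
      case equal
      then show False using lt abc gl(2)[of b] g1 by simp
    next
      case greater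
      then have a: "Suc j < a"
        using gh(2)[of c] high_iff[of a] lt abc by simp
      then have "r (b - Suc j) < r (c - Suc j) \<and> r (c - Suc j) < r (a - Suc j)"
        using lt gh(1)[of a] gh(1)[of b] gh(1)[of c] abc by simp
      moreover have "1 \<le> a - Suc j" "a - Suc j < b - Suc j" "b - Suc j < c - Suc j" "c - Suc j \<le> n"
        using a abc by simp_all
      ultimately show False using rav by blast
    qed
  qed
  moreover have "P i (?g i)" if "1 \<le> i" "i \<le> Suc j + n" for i
  proof (cases i "Suc j" rule: linorder_cases)
    case less
    then show ?thesis using tP[of i] gl(1)[of i] that by simp
  next
    case equal
    then show ?thesis using P1 g1 by simp
  next
    case greater
    then show ?thesis using rP[of "i - Suc j"] gh(1)[of i] that by simp
  qed
  ultimately show ?thesis unfolding avoiders_def by simp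
qed

lemma unglue_in_avoiders:
  assumes s: "s \<in> avoiders P (Suc j + n)" and s1: "s (Suc j) = 1"
  shows "P (Suc j) 1"
    and "fst (unglue j n s) \<in> avoiders (\<lambda>i v. P i (Suc v)) j"
    and "snd (unglue j n s) \<in> avoiders (\<lambda>i v. P (i + Suc j) (v + Suc j)) n"
    and "glue j n (unglue j n s) = s"
proof -
  have p: "s permutes {1..Suc j + n}"
    and av: "\<And>a b c. 1 \<le> a \<Longrightarrow> a < b \<Longrightarrow> b < c \<Longrightarrow> c \<le> Suc j + n \<Longrightarrow> \<not> (s b < s c \<and> s c < s a)"
    and sP: "\<And>i. 1 \<le> i \<Longrightarrow> i \<le> Suc j + n \<Longrightarrow> P i (s i)"
    using s unfolding avoiders_def by auto
  have inj: "s x = s y \<longleftrightarrow> x = y" for x y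
    using permutes_inj[OF p] by (rule inj_eq)
  have im: "s ` {1..Suc j} = {1..Suc j}"
    using avoider_prefix_image[OF s _ s1] by simp
  have lo: "2 \<le> s i \<and> s i \<le> Suc j" if "1 \<le> i" "i \<le> j" for i
  proof -
    have "s i \<in> s ` {1..Suc j}" using that by auto
    then have "s i \<in> {1..Suc j}" unfolding im .
    moreover have "s i \<noteq> 1" using inj[of i "Suc j"] s1 that by auto
    ultimately show ?thesis by auto
  qed
  have hi: "Suc j < s (i + Suc j) \<and> s (i + Suc j) \<le> Suc j + n" if "1 \<le> i" "i \<le> n" for i
  proof -
    have "s (i + Suc j) \<in> {1..Suc j + n}"
      using permutes_in_image[OF p, of "i + Suc j"] that by auto
    moreover have "s (i + Suc j) \<notin> s ` {1..Suc j}" using inj that by auto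
    ultimately show ?thesis unfolding im by auto
  qed
  show "P (Suc j) 1" using sP[of "Suc j"] s1 by simp
  let ?t = "fst (unglue j n s)" and ?r = "snd (unglue j n s)"
  have t: "s i = Suc (?t i)" if "1 \<le> i" "i \<le> j" for i
    using lo[OF that] that by (simp add: unglue_def)
  have r: "s (i + Suc j) = ?r i + Suc j" if "1 \<le> i" "i \<le> n" for i
    using hi[OF that] that by (simp add: unglue_def)
  have tr: "1 \<le> ?t i \<and> ?t i \<le> j" if "1 \<le> i" "i \<le> j" for i
    using lo[OF that] t[OF that] by simp
  have rr: "1 \<le> ?r i \<and> ?r i \<le> n" if "1 \<le> i" "i \<le> n" for i
    using hi[OF that] r[OF that] by simp
  have "?t permutes {1..j}"
  proof (rule permutesI_inj_on)
    show "inj_on ?t {1..j}"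
      by (rule inj_onI) (metis t inj atLeastAtMost_iff)
  qed (use tr in \<open>auto simp: unglue_def\<close>)
  moreover have "\<not> (?t b < ?t c \<and> ?t c < ?t a)"
    if "1 \<le> a" "a < b" "b < c" "c \<le> j" for a b c
    using av[of a b c] that t[of a] t[of b] t[of c] by simp
  moreover have "P i (Suc (?t i))" if "1 \<le> i" "i \<le> j" for i
    using sP[of i] t[of i] that by simp
  ultimately show "?t \<in> avoiders (\<lambda>i v. P i (Suc v)) j"
    unfolding avoiders_def by simp
  have "?r permutes {1..n}"
  proof (rule permutesI_inj_on)
    show "inj_on ?r {1..n}"
      by (rule inj_onI) (metis r inj atLeastAtMost_iff add_right_cancel)
  qed (use rr in \<open>auto simp: unglue_def\<close>)
  moreover have "\<not> (?r b < ?r c \<and> ?r c < ?r a)"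
    if "1 \<le> a" "a < b" "b < c" "c \<le> n" for a b c
    using av[of "a + Suc j" "b + Suc j" "c + Suc j"] that r[of a] r[of b] r[of c] by simp
  moreover have "P (i + Suc j) (?r i + Suc j)" if "1 \<le> i" "i \<le> n" for i
    using sP[of "i + Suc j"] r[of i] that by simp
  ultimately show "?r \<in> avoiders (\<lambda>i v. P (i + Suc j) (v + Suc j)) n"
    unfolding avoiders_def by simp
  show "glue j n (unglue j n s) = s"
  proof
    fix i
    consider "1 \<le> i" "i \<le> j" | "i = Suc j" | k where "i = k + Suc j" "1 \<le> k" "k \<le> n" | "i \<notin> {1..Suc j + n}"
      by atomize_elim (auto intro!: exI[of _ "i - Suc j"])
    then show "glue j n (unglue j n s) i = s i"
    proof cases
      case 1
      then show ?thesis using t[of i] by (simp add: glue_def split_beta)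
    next
      case 2
      then show ?thesis using s1 by (simp add: glue_def split_beta)
    next
      case 3
      then show ?thesis using r[of k] by (simp add: glue_def split_beta)
    next
      case 4
      then show ?thesis using permutes_not_in[OF p 4] by (auto simp: glue_def split_beta)
    qed
  qed
qed

lemma unglue_glue:
  assumes t: "t permutes {1..j}" and r: "r permutes {1..n}"
  shows "unglue j n (glue j n (t, r)) = (t, r)"
  using permutes_not_in[OF t] permutes_not_in[OF r]
  by (auto simp: unglue_def glue_def fun_eq_iff)

lemma card_avoiders_slice:
  "card {s \<in> avoiders P (Suc j + n). s (Suc j) = 1} =
     (if P (Suc j) 1
      then card (avoiders (\<lambda>i v. P i (Suc v)) j) *
           card (avoiders (\<lambda>i v. P (i + Suc j) (v + Suc j)) n)
      else 0)"
proof (cases "P (Suc j) 1")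
  case True
  let ?T = "avoiders (\<lambda>i v. P i (Suc v)) j"
    and ?R = "avoiders (\<lambda>i v. P (i + Suc j) (v + Suc j)) n"
  have "bij_betw (glue j n) (?T \<times> ?R) {s \<in> avoiders P (Suc j + n). s (Suc j) = 1}"
  proof (rule bij_betw_byWitness[where f' = "unglue j n"])
    show "\<forall>x\<in>?T \<times> ?R. unglue j n (glue j n x) = x"
      by (auto simp: avoiders_def unglue_glue)
    show "\<forall>s\<in>{s \<in> avoiders P (Suc j + n). s (Suc j) = 1}. glue j n (unglue j n s) = s"
      using unglue_in_avoiders(4) by blast
    show "glue j n ` (?T \<times> ?R) \<subseteq> {s \<in> avoiders P (Suc j + n). s (Suc j) = 1}"
      using glue_in_avoiders[of P j, OF True] by (auto simp: glue_def)
    show "unglue j n ` {s \<in> avoiders P (Suc j + n). s (Suc j) = 1} \<subseteq> ?T \<times> ?R"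
    proof (intro subsetI, elim imageE CollectE conjE)
      fix x s assume "x = unglue j n s" "s \<in> avoiders P (Suc j + n)" "s (Suc j) = 1"
      then show "x \<in> ?T \<times> ?R"
        using unglue_in_avoiders(2,3)[of s P j n] by (simp add: mem_Times_iff)
    qed
  qed
  then show ?thesis using True by (simp add: bij_betw_same_card[symmetric] card_cartesian_product)
next
  case False
  then have "{s \<in> avoiders P (Suc j + n). s (Suc j) = 1} = {}"
    using unglue_in_avoiders(1) by blast
  then show ?thesis using False by simp
qed

lemma card_avoiders_Suc:
  "card (avoiders P (Suc N)) =
     (\<Sum>j\<le>N. if P (Suc j) 1
        then card (avoiders (\<lambda>i v. P i (Suc v)) j) *
             card (avoiders (\<lambda>i v. P (i + Suc j) (v + Suc j)) (N - j))
        else 0)"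
proof -
  let ?S = "\<lambda>j. {s \<in> avoiders P (Suc N). s (Suc j) = 1}"
  have "avoiders P (Suc N) = (\<Union>j\<in>{..N}. ?S j)"
  proof (intro equalityI subsetI)
    fix s assume s: "s \<in> avoiders P (Suc N)"
    then have "1 \<in> s ` {1..Suc N}"
      using permutes_image[of s "{1..Suc N}"] by (auto simp: avoiders_def)
    then obtain i where "i \<in> {1..Suc N}" "s i = 1" by auto
    with s show "s \<in> (\<Union>j\<in>{..N}. ?S j)"
      by (auto intro!: bexI[of _ "i - 1"])
  qed auto
  then have "card (avoiders P (Suc N)) = card (\<Union>j\<in>{..N}. ?S j)" by simp
  also have "\<dots> = (\<Sum>j\<le>N. card (?S j))"
  proof (rule card_UN_disjoint)
    have "i = j" if "s \<in> avoiders P (Suc N)" "s (Suc i) = 1" "s (Suc j) = 1" for s i j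
    proof -
      have "inj s" using that(1) unfolding avoiders_def by (auto intro: permutes_inj)
      then show ?thesis using that inj_eq[of s "Suc i" "Suc j"] by simp
    qed
    then show "\<forall>i\<in>{..N}. \<forall>j\<in>{..N}. i \<noteq> j \<longrightarrow> ?S i \<inter> ?S j = {}" by blast
  qed auto
  also have "\<dots> = (\<Sum>j\<le>N. if P (Suc j) 1
        then card (avoiders (\<lambda>i v. P i (Suc v)) j) *
             card (avoiders (\<lambda>i v. P (i + Suc j) (v + Suc j)) (N - j))
        else 0)"
  proof (rule sum.cong[OF refl])
    fix j assume "j \<in> {..N}"
    then have "Suc N = Suc j + (N - j)" by simp
    then show "card (?S j) = (if P (Suc j) 1
        then card (avoiders (\<lambda>i v. P i (Suc v)) j) *
             card (avoiders (\<lambda>i v. P (i + Suc j) (v + Suc j)) (N - j))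
        else 0)"
      using card_avoiders_slice[of P j "N - j"] by simp
  qed
  finally show ?thesis .
qed

text \<open>
  Without a condition the cut gives the Catalan recurrence.
\<close>

lemma card_avoiders_True: "of_nat (card (avoiders (\<lambda>i v. True) N)) = catalan N"
proof (induction N rule: less_induct)
  case (less N)
  show ?case
  proof (cases N)
    case (Suc n)
    have "of_nat (card (avoiders (\<lambda>i v. True) (Suc n))) =
        (\<Sum>j\<le>n. of_nat (card (avoiders (\<lambda>i v. True) j)) *
          (of_nat (card (avoiders (\<lambda>i v. True) (n - j))) :: rat))"
      by (subst card_avoiders_Suc) simp
    also have "\<dots> = (\<Sum>j\<le>n. catalan j * catalan (n - j))"
      using less Suc by (intro sum.cong) auto
    finally show ?thesis using Suc catalan_convolution by simp
  qed simp
qed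

section \<open>Parity classes\<close>

text \<open>
  The flags \<open>p\<close> and \<open>q\<close> say whether the position and the value of an \<open>m\<close>-deficiency have to be even
  (true) or odd (false). All four combinations arise from even-even by cutting.
\<close>

definition parity_cond :: "bool \<Rightarrow> bool \<Rightarrow> nat \<Rightarrow> nat \<Rightarrow> nat \<Rightarrow> bool" where
  "parity_cond p q m i v \<longleftrightarrow> (v + m \<le> i \<longrightarrow> (even i \<longleftrightarrow> p) \<and> (even v \<longleftrightarrow> q))"

definition parity_count :: "bool \<Rightarrow> bool \<Rightarrow> nat \<Rightarrow> nat \<Rightarrow> rat" where
  "parity_count p q m N = of_nat (card (avoiders (parity_cond p q m) N))"

text \<open>
  The contribution of the part before the value \<open>1\<close> when this value stands at position \<open>j + 1\<close>: it is
  zero if the \<open>1\<close> is itself a forbidden \<open>m\<close>-deficiency, that is, if \<open>j \<ge> m\<close> and not both \<open>j + 1\<close>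
  and \<open>1\<close> have the prescribed parities.
\<close>

definition split_weight :: "bool \<Rightarrow> bool \<Rightarrow> nat \<Rightarrow> nat \<Rightarrow> rat" where
  "split_weight p q m j = (if j < m \<or> ((odd j \<longleftrightarrow> p) \<and> \<not> q) then parity_count p (\<not> q) (Suc m) j else 0)"

text \<open>
  A permutation of \<open>[N]\<close> has no \<open>m\<close>-deficiency if \<open>N \<le> m\<close>.
\<close>

lemma parity_count_small: "N \<le> m \<Longrightarrow> parity_count p q m N = catalan N"
  unfolding parity_count_def card_avoiders_True[symmetric]
  by (intro arg_cong[where f = "\<lambda>A. of_nat (card A)"] avoiders_cong) (auto simp: parity_cond_def)

lemma parity_count_Suc:
  "parity_count p q m (Suc N) =
     (\<Sum>j\<le>N. split_weight p q m j * parity_count (odd j \<longleftrightarrow> p) (odd j \<longleftrightarrow> q) m (N - j))"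
proof -
  have 1: "parity_cond p q m i (Suc v) = parity_cond p (\<not> q) (Suc m) i v" for i v
    by (auto simp: parity_cond_def)
  have 2: "parity_cond p q m (i + Suc j) (v + Suc j) =
      parity_cond (odd j \<longleftrightarrow> p) (odd j \<longleftrightarrow> q) m i v" for i v j
    by (auto simp: parity_cond_def)
  have 3: "parity_cond p q m (Suc j) 1 \<longleftrightarrow> j < m \<or> ((odd j \<longleftrightarrow> p) \<and> \<not> q)" for j
    by (auto simp: parity_cond_def)
  show ?thesis
    unfolding parity_count_def card_avoiders_Suc 1 2 3 split_weight_def
    by (auto simp: of_nat_sum intro!: sum.cong)
qed

definition parity_gf :: "bool \<Rightarrow> (nat \<Rightarrow> rat) \<Rightarrow> rat fps" where
  "parity_gf e f = Abs_fps (\<lambda>N. if even N \<longleftrightarrow> e then f N else 0)"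

text \<open>
  Size \<open>N + 1\<close> splits into \<open>j\<close> entries, the \<open>1\<close>, and \<open>N - j\<close> entries. For odd \<open>j\<close> the second part has
  the same size parity and the same prescribed parities as the whole; for even \<open>j\<close> all three flip.
  This is why prescribed parities and size parity can be tied together in one series.
\<close>

lemma parity_gf_parity_count:
  "parity_gf e (parity_count p q m) = (if e then 1 else 0) + fps_X *
     (parity_gf False (split_weight p q m) * parity_gf e (parity_count p q m) +
      parity_gf True (split_weight p q m) * parity_gf (\<not> e) (parity_count (\<not> p) (\<not> q) m))"
proof (rule fps_ext)
  fix n
  show "parity_gf e (parity_count p q m) $ n = ((if e then 1 else 0) + fps_X *
     (parity_gf False (split_weight p q m) * parity_gf e (parity_count p q m) +
      parity_gf True (split_weight p q m) * parity_gf (\<not> e) (parity_count (\<not> p) (\<not> q) m))) $ n"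
  proof (cases n)
    case 0
    then show ?thesis by (simp add: parity_gf_def parity_count_small)
  next
    case (Suc N)
    have "parity_gf e (parity_count p q m) $ Suc N =
        (\<Sum>j\<le>N. (if even (Suc N) \<longleftrightarrow> e
           then split_weight p q m j * parity_count (odd j \<longleftrightarrow> p) (odd j \<longleftrightarrow> q) m (N - j) else 0))"
      by (simp add: parity_gf_def parity_count_Suc)
    also have "\<dots> = (\<Sum>j\<le>N.
        parity_gf False (split_weight p q m) $ j * parity_gf e (parity_count p q m) $ (N - j) +
        parity_gf True (split_weight p q m) $ j * parity_gf (\<not> e) (parity_count (\<not> p) (\<not> q) m) $ (N - j))"
      by (intro sum.cong) (auto simp: parity_gf_def)
    also have "\<dots> = (parity_gf False (split_weight p q m) * parity_gf e (parity_count p q m) +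
        parity_gf True (split_weight p q m) * parity_gf (\<not> e) (parity_count (\<not> p) (\<not> q) m)) $ N"
      by (simp only: fps_add_nth fps_mult_nth sum.distrib atLeast0AtMost)
    finally show ?thesis
      by (simp add: Suc)
  qed
qed

lemma C_even_nth: "C_even j $ n = (if even n \<and> int n \<le> j then catalan n else 0)"
proof -
  have fin: "finite {i::nat. 2 * int i \<le> j}"
    by (rule finite_subset[of _ "{..nat j}"]) auto
  have "C_even j $ n = (\<Sum>i | 2 * int i \<le> j. if n = 2 * i then catalan n else 0)"
    unfolding C_even_def fps_sum_nth by (intro sum.cong) (auto simp: fps_X_power_nth)
  also have "\<dots> = (if even n \<and> int n \<le> j then catalan n else 0)"
  proof (cases "even n")
    case True
    then obtain l where n: "n = 2 * l" by auto
    have "(\<Sum>i | 2 * int i \<le> j. if n = 2 * i then catalan n else 0) =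
        (\<Sum>i | 2 * int i \<le> j. if l = i then catalan n else 0)"
      by (intro sum.cong) (auto simp: n)
    then show ?thesis using fin by (simp add: n)
  qed (auto intro!: sum.neutral)
  finally show ?thesis .
qed

lemma C_odd_nth: "C_odd j $ n = (if odd n \<and> int n \<le> j then catalan n else 0)"
proof -
  have fin: "finite {i::nat. 2 * int i + 1 \<le> j}"
    by (rule finite_subset[of _ "{..nat j}"]) auto
  have "C_odd j $ n = (\<Sum>i | 2 * int i + 1 \<le> j. if n = 2 * i + 1 then catalan n else 0)"
    unfolding C_odd_def fps_sum_nth
    by (intro sum.cong) (auto simp: fps_X_power_nth simp del: power_Suc)
  also have "\<dots> = (if odd n \<and> int n \<le> j then catalan n else 0)"
  proof (cases "odd n")
    case True
    then obtain l where n: "n = 2 * l + 1" by (rule oddE)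
    have "(\<Sum>i | 2 * int i + 1 \<le> j. if n = 2 * i + 1 then catalan n else 0) =
        (\<Sum>i | 2 * int i + 1 \<le> j. if l = i then catalan n else 0)"
      by (intro sum.cong) (auto simp: n)
    then show ?thesis using fin by (simp add: n)
  qed (auto intro!: sum.neutral)
  finally show ?thesis .
qed

lemma R_perms_eq: "R_perms m N = avoiders (parity_cond True True m) N"
  unfolding R_perms_def avoiders_def parity_cond_def contains_pattern_312_iff by auto

lemma R_gf_eq: "R_gf m = parity_gf False (parity_count True True m)"
  unfolding R_gf_def parity_gf_def parity_count_def R_perms_eq by (rule fps_ext) simp

text \<open>
  The equations for \<open>R\<close>, \<open>S\<close>, \<open>E\<close> and \<open>O'\<close> are the cut applied to the four parity classes that arise
  from even-even. Among the eight weights, only two are not truncated Catalan series: in the odd-odd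
  class the \<open>1\<close> may be a deficiency at an odd position, which brings in \<open>E\<close>, and in the even-odd class
  at an even position, which brings in the even-even class for \<open>m + 2\<close>, that is \<open>R'\<close>.
\<close>

lemma R_gf_recurrence:
  "fps_X * R_gf (2 * k + 1) =
     (fps_X ^ 2 * C_even (2 * int k)) /
     ((1 - fps_X * C_odd (2 * int k - 1)) ^ 2 -
       (fps_X ^ 2 * C_even (2 * int k)) /
       (1 - fps_X * C_odd (2 * int k + 1) -
         (fps_X ^ 2 * C_even (2 * int k) ^ 2) /
         (1 - fps_X * R_gf (2 * k + 3))))"
proof -
  let ?m = "2 * k + 1"
  define X :: "rat fps" where "X = fps_X"
  define Ce Cm Cp where "Ce = C_even (2 * int k)" "Cm = C_odd (2 * int k - 1)" "Cp = C_odd (2 * int k + 1)"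
  define R R' where "R = R_gf ?m" "R' = R_gf (2 * k + 3)"
  define S E O' where "S = parity_gf True (parity_count False False ?m)"
    "E = parity_gf True (parity_count False True (Suc ?m))" "O' = parity_gf False (parity_count True False (Suc ?m))"
  have odd_bound: "int n < 2 * int k" if "odd n" "n < Suc (2 * k)" for n
    using that by presburger
  have Req: "R = X * (Cm * R + Ce * S)"
  proof -
    have "parity_gf False (split_weight True True ?m) = Cm" "parity_gf True (split_weight True True ?m) = Ce"
      by (auto simp: Ce_Cm_Cp_def fps_eq_iff C_odd_nth C_even_nth parity_gf_def split_weight_def
          parity_count_small dest: odd_bound)
    then show ?thesis
      using parity_gf_parity_count[of False True True ?m] by (simp add: R_R'_def R_gf_eq S_E_O'_def X_def)
  qed
  have Seq: "S = 1 + X * (Cm * S + E * R)"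
  proof -
    have "parity_gf False (split_weight False False ?m) = Cm" "parity_gf True (split_weight False False ?m) = E"
      by (auto simp: Ce_Cm_Cp_def S_E_O'_def fps_eq_iff C_odd_nth parity_gf_def split_weight_def
          parity_count_small dest: odd_bound)
    then show ?thesis
      using parity_gf_parity_count[of True False False ?m] by (simp add: R_R'_def R_gf_eq S_E_O'_def X_def)
  qed
  have Eeq: "E = 1 + X * (Cp * E + Ce * O')"
  proof -
    have "parity_gf False (split_weight False True (Suc ?m)) = Cp" "parity_gf True (split_weight False True (Suc ?m)) = Ce"
      by (auto simp: Ce_Cm_Cp_def fps_eq_iff C_odd_nth C_even_nth parity_gf_def split_weight_def
          parity_count_small dest: odd_bound)
    then show ?thesis
      using parity_gf_parity_count[of True False True "Suc ?m"] by (simp add: S_E_O'_def X_def)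
  qed
  have Oeq: "O' = X * (R' * O' + Ce * E)"
  proof -
    have "parity_gf False (split_weight True False (Suc ?m)) = R'" "parity_gf True (split_weight True False (Suc ?m)) = Ce"
      by (auto simp: Ce_Cm_Cp_def R_R'_def R_gf_eq fps_eq_iff C_even_nth parity_gf_def split_weight_def
          parity_count_small numeral_3_eq_3)
    then show ?thesis
      using parity_gf_parity_count[of False True False "Suc ?m"] by (simp add: S_E_O'_def X_def)
  qed
  have X0: "X $ 0 = 0" by (simp add: X_def)
  have unit: "b \<noteq> 0" if "b $ 0 = 1" for b :: "rat fps"
    using that by auto
  have divI: "a / b = c" if "b $ 0 = 1" "c * b = a" for a b c :: "rat fps"
    using that unit[OF that(1)] by (metis nonzero_mult_div_cancel_right)
  have div_mult: "a / b * b = a" if "b $ 0 = 1" for a b :: "rat fps"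
    using that by (simp add: fps_divide_unit mult.assoc inverse_mult_eq_1)
  define U where "U = X ^ 2 * Ce ^ 2 / (1 - X * R')"
  have U: "U * (1 - X * R') = X ^ 2 * Ce ^ 2"
    unfolding U_def by (rule div_mult) (simp add: X0)
  have U0: "U $ 0 = 0"
    using arg_cong[OF U, of "\<lambda>f. f $ 0"] by (simp add: X0)
  \<comment> \<open>The series \<open>U\<close> is the innermost fraction; the next steps show \<open>E = 1 / (1 - X * Cp - U)\<close>.\<close>
  have "X * Ce * O' * (1 - X * R') = U * E * (1 - X * R')"
    using Oeq U by algebra
  moreover have "1 - X * R' \<noteq> 0" by (rule unit) (simp add: X0)
  ultimately have "X * Ce * O' = U * E" by simp
  then have "E * (1 - X * Cp - U) = 1" using Eeq by algebra
  then have V: "X ^ 2 * Ce / (1 - X * Cp - U) = X ^ 2 * Ce * E"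
    by (intro divI) (simp_all add: X0 U0 mult.assoc)
  have "X ^ 2 * Ce / ((1 - X * Cm) ^ 2 - X ^ 2 * Ce * E) = X * R"
  proof (rule divI)
    show "((1 - X * Cm) ^ 2 - X ^ 2 * Ce * E) $ 0 = 1"
      by (simp add: X0 power2_eq_square)
    show "X * R * ((1 - X * Cm) ^ 2 - X ^ 2 * Ce * E) = X ^ 2 * Ce"
      using Req Seq by algebra
  qed
  then show ?thesis
    using V unfolding U_def X_def Ce_Cm_Cp_def R_R'_def by simp
qed

section \<open>Dumont permutations\<close>

text \<open>
  Permutations are functions on all natural numbers that fix everything off the board, so
  appending the fixed point \<open>2 * n + 1\<close> leaves the function as it is, and the two sets coincide.
\<close>

lemma dumont4_avoiding_eq: "dumont4_avoiding [1, 4, 2, 3] n = R_perms 1 (2 * n + 1)"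
proof (intro equalityI subsetI)
  fix p assume "p \<in> dumont4_avoiding [1, 4, 2, 3] n"
  then have p: "p permutes {1..2 * n}"
    and d: "\<And>i. 1 \<le> i \<Longrightarrow> i \<le> 2 * n \<Longrightarrow> p i < i \<Longrightarrow> even i \<and> even (p i)"
    and av: "\<not> contains_pattern (2 * n) p [1, 4, 2, 3]"
    unfolding dumont4_avoiding_def dumont4_def by auto
  have last: "p (2 * n + 1) = 2 * n + 1" using permutes_not_in[OF p] by simp
  have rng: "1 \<le> p i \<and> p i \<le> 2 * n" if "1 \<le> i" "i \<le> 2 * n" for i
    using permutes_in_image[OF p, of i] that by auto
  have "\<not> contains_pattern (2 * n + 1) p [3, 1, 2]"
  proof
    assume "contains_pattern (2 * n + 1) p [3, 1, 2]"
    then obtain a b c where abc: "1 \<le> a" "a < b" "b < c" "c \<le> 2 * n + 1" "p b < p c" "p c < p a"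
      unfolding contains_pattern_312_iff by blast
    have c: "c \<le> 2 * n" using abc last rng[of a] by (cases "c = 2 * n + 1") auto
    have p1: "p 1 = 1"
    proof -
      have "1 \<in> p ` {1..2 * n}" using permutes_image[OF p] c abc by auto
      then obtain i where "1 \<le> i" "i \<le> 2 * n" "p i = 1" by auto
      with d[of i] show ?thesis by (cases "i = 1") auto
    qed
    have "a \<noteq> 1" using abc p1 by (cases "a = 1") auto
    moreover have "p b \<noteq> p 1" using inj_eq[OF permutes_inj[OF p], of b 1] abc by simp
    ultimately have "1 < a" "p 1 < p b" using abc rng[of b] p1 c by auto
    then have "contains_pattern (2 * n) p [1, 4, 2, 3]"
      unfolding contains_pattern_1423_iff using abc c
      by (intro exI[of _ 1] exI[of _ a] exI[of _ b] exI[of _ c]) auto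
    with av show False ..
  qed
  moreover have "p permutes {1..2 * n + 1}"
    using p by (rule permutes_subset) auto
  moreover have "even i \<and> even (p i)" if "1 \<le> i" "i \<le> 2 * n + 1" "p i + 1 \<le> i" for i
    using that d[of i] last by (cases "i = 2 * n + 1") auto
  ultimately show "p \<in> R_perms 1 (2 * n + 1)"
    unfolding R_perms_def by auto
next
  fix p assume "p \<in> R_perms 1 (2 * n + 1)"
  then have p: "p permutes {1..2 * n + 1}"
    and d: "\<And>i. 1 \<le> i \<Longrightarrow> i \<le> 2 * n + 1 \<Longrightarrow> p i + 1 \<le> i \<Longrightarrow> even i \<and> even (p i)"
    and av: "\<not> contains_pattern (2 * n + 1) p [3, 1, 2]"
    unfolding R_perms_def by auto
  have "p (2 * n + 1) \<in> {1..2 * n + 1}"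
    using permutes_in_image[OF p, of "2 * n + 1"] by simp
  then have last: "p (2 * n + 1) = 2 * n + 1"
    using d[of "2 * n + 1"] by (cases "p (2 * n + 1) = 2 * n + 1") auto
  have "p permutes {1..2 * n}"
    using p by (rule permutes_superset) (use last in \<open>auto simp: le_Suc_eq\<close>)
  moreover have "\<not> contains_pattern (2 * n) p [1, 4, 2, 3]"
  proof
    assume "contains_pattern (2 * n) p [1, 4, 2, 3]"
    then obtain a b c d where "1 \<le> a" "a < b" "b < c" "c < d" "d \<le> 2 * n" "p c < p d" "p d < p b"
      unfolding contains_pattern_1423_iff by blast
    then have "contains_pattern (2 * n + 1) p [3, 1, 2]"
      unfolding contains_pattern_312_iff
      by (intro exI[of _ b] exI[of _ c] exI[of _ d]) auto
    with av show False ..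
  qed
  ultimately show "p \<in> dumont4_avoiding [1, 4, 2, 3] n"
    unfolding dumont4_avoiding_def dumont4_def using d by auto
qed

lemma fps_compose_X_power2_nth:
  "(f oo (fps_X ^ 2)) $ n = (if even n then f $ (n div 2) else (0 :: 'a :: comm_ring_1))"
proof -
  have "(f oo (fps_X ^ 2)) $ n = (\<Sum>i=0..n. if n = 2 * i then f $ i else 0)"
    unfolding fps_compose_nth power_mult[symmetric]
    by (intro sum.cong) (auto simp: fps_X_power_nth)
  also have "\<dots> = (if even n then f $ (n div 2) else 0)"
  proof (cases "even n")
    case True
    then have "(\<Sum>i=0..n. if n = 2 * i then f $ i else 0) =
        (\<Sum>i=0..n. if n div 2 = i then f $ i else 0)"
      by (intro sum.cong) auto
    then show ?thesis using True by simp
  qed (auto intro!: sum.neutral)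
  finally show ?thesis .
qed

theorem theorem3p12:
  shows "Abs_fps (\<lambda>n. of_nat (card (dumont4_avoiding [1, 4, 2, 3] n)) :: rat) oo (fps_X ^ 2)
           = R_gf 1 / fps_X
       \<and> R_gf 1 / fps_X = (fps_X * R_gf 1) / fps_X ^ 2
       \<and> (\<forall>k::nat.
            fps_X * R_gf (2 * k + 1) =
              (fps_X ^ 2 * C_even (2 * int k)) /
              ((1 - fps_X * C_odd (2 * int k - 1)) ^ 2 -
                (fps_X ^ 2 * C_even (2 * int k)) /
                (1 - fps_X * C_odd (2 * int k + 1) -
                  (fps_X ^ 2 * C_even (2 * int k) ^ 2) /
                  (1 - fps_X * R_gf (2 * k + 3)))))"
proof (intro conjI allI)
  let ?D = "Abs_fps (\<lambda>n. of_nat (card (dumont4_avoiding [1, 4, 2, 3] n)) :: rat) oo (fps_X ^ 2)"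
  have "R_gf 1 = fps_X * ?D"
  proof (rule fps_ext)
    fix n
    show "R_gf 1 $ n = (fps_X * ?D) $ n"
      by (cases n) (auto simp: R_gf_def dumont4_avoiding_eq[simplified] fps_compose_X_power2_nth)
  qed
  then show "?D = R_gf 1 / fps_X"
    using nonzero_mult_div_cancel_left[of "fps_X :: rat fps" ?D] by (simp only:) simp
  show "R_gf 1 / fps_X = (fps_X * R_gf 1) / fps_X ^ 2"
    by (simp add: power2_eq_square)
qed (rule R_gf_recurrence)

end
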